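(* Let $\mathcal K$ be a Cartesian category and $A,B$ objects of $\mathcal K$. Any adjunction $F:\mathcal K/B\rightleftarrows (A\times -)/B:G$ (with $F\dashv G$) fibered over $\mathcal K$ induces an adjunction $\mathrm{Mre}(A,B)\rightleftarrows\mathrm{Mly}(A,B)$ fibered over $\mathrm{Alg}(A\times -)$, namely the one whose left and right adjoints are the functors obtained by pulling back $F$ and $G$ respectively.
   Context: $\mathrm{Alg}(A\times-)$ is the category of endofunctor algebras $d:A\times E\to E$, with forgetful functor $(E,d)\mapsto E$ to $\mathcal K$. $(A\times-)/B$ is the comma category of pairs $(X,\,A\times X\to B)$, with forgetful functor to $\mathcal K$ sending such a pair to $X$. $\mathcal K/B$ is the slice category, with domain functor to $\mathcal K$. The category $\mathrm{Mly}(A,B)$ of Mealy machines is the strict pullback in $\mathbf{Cat}$ of $\mathrm{Alg}(A\times-)\to\mathcal K\leftarrow (A\times-)/B$. The category $\mathrm{Mre}(A,B)$ of Moore machines is the strict pullback of $\mathrm{Alg}(A\times-)\to\mathcal K\leftarrow\mathcal K/B$. Both have a projection functor to $\mathrm{Alg}(A\times-)$. For categories $\mathcal X,\mathcal Y$ with functors $p:\mathcal X\to\mathcal C$, $q:\mathcal Y\to\mathcal C$, an adjunction $F:\mathcal X\rightleftarrows\mathcal Y:G$ is fibered over $\mathcal C$ if it is an adjunction in the 2-category $\mathbf{Cat}/\mathcal C$: $qF=p$, $pG=q$, and the components of unit and counit are sent to identities by $p$ and $q$ respectively. If $F$ is a functor over $\mathcal K$ between the two comma categories, the functor obtained by pulling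 it back is the one induced on the strict pullbacks, acting as the identity on the $\mathrm{Alg}(A\times-)$ component and as $F$ on the other. *)

theory Defs
  imports Main
begin

text \<open>Composition is written in the usual order: \<open>g \<cdot> f\<close> means first \<open>f\<close>, then \<open>g\<close>.\<close>

record ('o, 'a) cat =
  Obj :: "'o set"
  Arr :: "'a set"
  Dom :: "'a \<Rightarrow> 'o"
  Cod :: "'a \<Rightarrow> 'o"
  Ide :: "'o \<Rightarrow> 'a"
  Cmp :: "'a \<Rightarrow> 'a \<Rightarrow> 'a"  (infixl "\<cdot>\<index>" 70)

definition hom :: "('o, 'a, 'm) cat_scheme \<Rightarrow> 'o \<Rightarrow> 'o \<Rightarrow> 'a set" where
  "hom C X Y = {f \<in> Arr C. Dom C f = X \<and> Cod C f = Y}"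

locale category =
  fixes C :: "('o, 'a, 'm) cat_scheme" (structure)
  assumes Dom_Obj: "f \<in> Arr C \<Longrightarrow> Dom C f \<in> Obj C"
    and Cod_Obj: "f \<in> Arr C \<Longrightarrow> Cod C f \<in> Obj C"
    and Ide_hom: "X \<in> Obj C \<Longrightarrow> Ide C X \<in> hom C X X"
    and Cmp_hom: "f \<in> hom C X Y \<Longrightarrow> g \<in> hom C Y Z \<Longrightarrow> g \<cdot> f \<in> hom C X Z"
    and Cmp_Ide: "f \<in> hom C X Y \<Longrightarrow> f \<cdot> Ide C X = f"
    and Ide_Cmp: "f \<in> hom C X Y \<Longrightarrow> Ide C Y \<cdot> f = f"
    and Cmp_assoc: "f \<in> hom C W X \<Longrightarrow> g \<in> hom C X Y \<Longrightarrow> h \<in> hom C Y Z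
      \<Longrightarrow> (h \<cdot> g) \<cdot> f = h \<cdot> (g \<cdot> f)"

record ('o, 'a, 'p, 'b) func =
  obj_map :: "'o \<Rightarrow> 'p"
  arr_map :: "'a \<Rightarrow> 'b"

locale cat_functor = C: category C + D: category D
  for C :: "('o, 'a, 'm) cat_scheme" and D :: "('p, 'b, 'n) cat_scheme" +
  fixes F :: "('o, 'a, 'p, 'b) func"
  assumes map_Obj: "X \<in> Obj C \<Longrightarrow> obj_map F X \<in> Obj D"
    and map_hom: "f \<in> hom C X Y \<Longrightarrow> arr_map F f \<in> hom D (obj_map F X) (obj_map F Y)"
    and map_Ide: "X \<in> Obj C \<Longrightarrow> arr_map F (Ide C X) = Ide D (obj_map F X)"
    and map_Cmp: "f \<in> hom C X Y \<Longrightarrow> g \<in> hom C Y Z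
      \<Longrightarrow> arr_map F (g \<cdot>\<^bsub>C\<^esub> f) = arr_map F g \<cdot>\<^bsub>D\<^esub> arr_map F f"

definition id_func :: "('o, 'a, 'o, 'a) func" where
  "id_func = \<lparr>obj_map = \<lambda>X. X, arr_map = \<lambda>f. f\<rparr>"

definition comp_func ::
    "('p, 'b, 'q, 'c) func \<Rightarrow> ('o, 'a, 'p, 'b) func \<Rightarrow> ('o, 'a, 'q, 'c) func" where
  "comp_func G F = \<lparr>obj_map = obj_map G \<circ> obj_map F, arr_map = arr_map G \<circ> arr_map F\<rparr>"

text \<open>Equality of functors with source \<open>C\<close>: the values of the underlying HOL functions
  outside \<open>C\<close> are irrelevant.\<close>

definition func_eq ::
    "('o, 'a, 'm) cat_scheme \<Rightarrow> ('o, 'a, 'p, 'b) func \<Rightarrow> ('o, 'a, 'p, 'b) func \<Rightarrow> bool" where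
  "func_eq C F G \<longleftrightarrow> (\<forall>X \<in> Obj C. obj_map F X = obj_map G X)
     \<and> (\<forall>f \<in> Arr C. arr_map F f = arr_map G f)"

locale nat_trans = F: cat_functor C D F + G: cat_functor C D G
  for C :: "('o, 'a, 'm) cat_scheme" and D :: "('p, 'b, 'n) cat_scheme"
    and F :: "('o, 'a, 'p, 'b) func" and G :: "('o, 'a, 'p, 'b) func" +
  fixes \<eta> :: "'o \<Rightarrow> 'b"
  assumes component: "X \<in> Obj C \<Longrightarrow> \<eta> X \<in> hom D (obj_map F X) (obj_map G X)"
    and naturality: "f \<in> hom C X Y \<Longrightarrow> \<eta> Y \<cdot>\<^bsub>D\<^esub> arr_map F f = arr_map G f \<cdot>\<^bsub>D\<^esub> \<eta> X"

text \<open>\<open>F\<close> is left adjoint to \<open>G\<close> with unit \<open>\<eta>\<close> and counit \<open>\<epsilon>\<close>.\<close>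

locale adjunction = F: cat_functor X Y F + G: cat_functor Y X G
    + unit: nat_trans X X id_func "comp_func G F" \<eta>
    + counit: nat_trans Y Y "comp_func F G" id_func \<epsilon>
  for X :: "('o, 'a, 'm) cat_scheme" and Y :: "('p, 'b, 'n) cat_scheme"
    and F :: "('o, 'a, 'p, 'b) func" and G :: "('p, 'b, 'o, 'a) func"
    and \<eta> :: "'o \<Rightarrow> 'a" and \<epsilon> :: "'p \<Rightarrow> 'b" +
  assumes triangle_left:
      "x \<in> Obj X \<Longrightarrow> \<epsilon> (obj_map F x) \<cdot>\<^bsub>Y\<^esub> arr_map F (\<eta> x) = Ide Y (obj_map F x)"
    and triangle_right:
      "y \<in> Obj Y \<Longrightarrow> arr_map G (\<epsilon> y) \<cdot>\<^bsub>X\<^esub> \<eta> (obj_map G y) = Ide X (obj_map G y)"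

locale fibered_adjunction = adjunction X Y F G \<eta> \<epsilon>
    + p: cat_functor X C p + q: cat_functor Y C q
  for C :: "('r, 'c, 'k) cat_scheme"
    and X :: "('o, 'a, 'm) cat_scheme" and Y :: "('p, 'b, 'n) cat_scheme"
    and p :: "('o, 'a, 'r, 'c) func" and q :: "('p, 'b, 'r, 'c) func"
    and F :: "('o, 'a, 'p, 'b) func" and G :: "('p, 'b, 'o, 'a) func"
    and \<eta> :: "'o \<Rightarrow> 'a" and \<epsilon> :: "'p \<Rightarrow> 'b" +
  assumes over_left: "func_eq X (comp_func q F) p"
    and over_right: "func_eq Y (comp_func p G) q"
    and unit_vertical: "x \<in> Obj X \<Longrightarrow> arr_map p (\<eta> x) = Ide C (obj_map p x)"
    and counit_vertical: "y \<in> Obj Y \<Longrightarrow> arr_map q (\<epsilon> y) = Ide C (obj_map q y)"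

text \<open>A Cartesian category carries chosen finite products: a terminal object and
  binary products.\<close>

record ('o, 'a) ccat = "('o, 'a) cat" +
  Terminal :: "'o"
  Prod :: "'o \<Rightarrow> 'o \<Rightarrow> 'o"
  Pr1 :: "'o \<Rightarrow> 'o \<Rightarrow> 'a"
  Pr2 :: "'o \<Rightarrow> 'o \<Rightarrow> 'a"

locale cartesian_category = category K
  for K :: "('o, 'a, 'm) ccat_scheme" (structure) +
  assumes Terminal_Obj: "Terminal K \<in> Obj K"
    and Terminal_universal: "X \<in> Obj K \<Longrightarrow> \<exists>!f. f \<in> hom K X (Terminal K)"
    and Prod_Obj: "X \<in> Obj K \<Longrightarrow> Y \<in> Obj K \<Longrightarrow> Prod K X Y \<in> Obj K"
    and Pr1_hom: "X \<in> Obj K \<Longrightarrow> Y \<in> Obj K \<Longrightarrow> Pr1 K X Y \<in> hom K (Prod K X Y) X"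
    and Pr2_hom: "X \<in> Obj K \<Longrightarrow> Y \<in> Obj K \<Longrightarrow> Pr2 K X Y \<in> hom K (Prod K X Y) Y"
    and Prod_universal: "f \<in> hom K Z X \<Longrightarrow> g \<in> hom K Z Y \<Longrightarrow>
      \<exists>!h. h \<in> hom K Z (Prod K X Y) \<and> Pr1 K X Y \<cdot> h = f \<and> Pr2 K X Y \<cdot> h = g"

definition prod_func :: "('o, 'a, 'm) ccat_scheme \<Rightarrow> 'o \<Rightarrow> ('o, 'a, 'o, 'a) func" where
  "prod_func K A = \<lparr>
     obj_map = \<lambda>X. Prod K A X,
     arr_map = \<lambda>f. THE h. h \<in> hom K (Prod K A (Dom K f)) (Prod K A (Cod K f))
       \<and> Pr1 K A (Cod K f) \<cdot>\<^bsub>K\<^esub> h = Pr1 K A (Dom K f)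
       \<and> Pr2 K A (Cod K f) \<cdot>\<^bsub>K\<^esub> h = f \<cdot>\<^bsub>K\<^esub> Pr2 K A (Dom K f)\<rparr>"

text \<open>Algebras and comma objects are pairs of an object and a structure arrow. One underlying
  arrow may give morphisms between several such pairs, so a morphism is encoded as a triple
  (source, target, underlying arrow).\<close>

definition alg_cat :: "('o, 'a, 'm) cat_scheme \<Rightarrow> ('o, 'a, 'o, 'a) func
    \<Rightarrow> ('o \<times> 'a, ('o \<times> 'a) \<times> ('o \<times> 'a) \<times> 'a) cat" where
  "alg_cat C T =
    (let Ob = {(E, d). E \<in> Obj C \<and> d \<in> hom C (obj_map T E) E} in
     \<lparr>Obj = Ob,
      Arr = {((E, d), (E', d'), h). (E, d) \<in> Ob \<and> (E', d') \<in> Ob \<and> h \<in> hom C E E'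
               \<and> h \<cdot>\<^bsub>C\<^esub> d = d' \<cdot>\<^bsub>C\<^esub> arr_map T h},
      Dom = \<lambda>(s, t, h). s,
      Cod = \<lambda>(s, t, h). t,
      Ide = \<lambda>(E, d). ((E, d), (E, d), Ide C E),
      Cmp = \<lambda>(s', t', h') (s, t, h). (s, t', h' \<cdot>\<^bsub>C\<^esub> h)\<rparr>)"

text \<open>The comma category \<open>T/B\<close> of a functor \<open>T\<close> from \<open>C\<close> to \<open>D\<close> over an object \<open>B\<close> of \<open>D\<close>.\<close>

definition comma_cat :: "('o, 'a, 'm) cat_scheme \<Rightarrow> ('p, 'b, 'n) cat_scheme
    \<Rightarrow> ('o, 'a, 'p, 'b) func \<Rightarrow> 'p \<Rightarrow> ('o \<times> 'b, ('o \<times> 'b) \<times> ('o \<times> 'b) \<times> 'a) cat" where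
  "comma_cat C D T B =
    (let Ob = {(X, s). X \<in> Obj C \<and> s \<in> hom D (obj_map T X) B} in
     \<lparr>Obj = Ob,
      Arr = {((X, s), (X', s'), h). (X, s) \<in> Ob \<and> (X', s') \<in> Ob \<and> h \<in> hom C X X'
               \<and> s' \<cdot>\<^bsub>D\<^esub> arr_map T h = s},
      Dom = \<lambda>(s, t, h). s,
      Cod = \<lambda>(s, t, h). t,
      Ide = \<lambda>(X, s). ((X, s), (X, s), Ide C X),
      Cmp = \<lambda>(s', t', h') (s, t, h). (s, t', h' \<cdot>\<^bsub>C\<^esub> h)\<rparr>)"

definition slice_cat :: "('o, 'a, 'm) cat_scheme \<Rightarrow> 'o
    \<Rightarrow> ('o \<times> 'a, ('o \<times> 'a) \<times> ('o \<times> 'a) \<times> 'a) cat" where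
  "slice_cat C B = comma_cat C C id_func B"

text \<open>The forgetful functor of \<open>alg_cat\<close> and of \<open>comma_cat\<close>, in particular the domain functor
  of a slice category.\<close>

definition forget :: "('o \<times> 'b, ('o \<times> 'b) \<times> ('o \<times> 'b) \<times> 'a, 'o, 'a) func" where
  "forget = \<lparr>obj_map = \<lambda>(X, s). X, arr_map = \<lambda>(s, t, h). h\<rparr>"

definition pullback_cat :: "('o, 'a, 'm) cat_scheme \<Rightarrow> ('p, 'b, 'n) cat_scheme
    \<Rightarrow> ('o, 'a, 'r, 'c) func \<Rightarrow> ('p, 'b, 'r, 'c) func \<Rightarrow> ('o \<times> 'p, 'a \<times> 'b) cat" where
  "pullback_cat X Y p q =
    \<lparr>Obj = {(x, y). x \<in> Obj X \<and> y \<in> Obj Y \<and> obj_map p x = obj_map q y},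
     Arr = {(f, g). f \<in> Arr X \<and> g \<in> Arr Y \<and> arr_map p f = arr_map q g},
     Dom = map_prod (Dom X) (Dom Y),
     Cod = map_prod (Cod X) (Cod Y),
     Ide = map_prod (Ide X) (Ide Y),
     Cmp = \<lambda>(f', g') (f, g). (f' \<cdot>\<^bsub>X\<^esub> f, g' \<cdot>\<^bsub>Y\<^esub> g)\<rparr>"

definition pullback_proj :: "('o \<times> 'p, 'a \<times> 'b, 'o, 'a) func" where
  "pullback_proj = \<lparr>obj_map = fst, arr_map = fst\<rparr>"

definition pullback_func :: "('p, 'b, 'q, 'c) func
    \<Rightarrow> ('o \<times> 'p, 'a \<times> 'b, 'o \<times> 'q, 'a \<times> 'c) func" where
  "pullback_func F =
    \<lparr>obj_map = map_prod id (obj_map F), arr_map = map_prod id (arr_map F)\<rparr>"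

text \<open>The transformation of pulled-back functors induced by a vertical transformation:
  the identity in the component from \<open>X\<close>, and \<open>\<eta>\<close> in the other.\<close>

definition pullback_trans :: "('o, 'a, 'm) cat_scheme \<Rightarrow> ('p \<Rightarrow> 'b)
    \<Rightarrow> 'o \<times> 'p \<Rightarrow> 'a \<times> 'b" where
  "pullback_trans X \<eta> = map_prod (Ide X) \<eta>"

text \<open>Mealy machines (\<open>Mly\<close>) and Moore machines (\<open>Mre\<close>), as strict pullbacks over \<open>K\<close>.\<close>

definition Mly :: "('o, 'a, 'm) ccat_scheme \<Rightarrow> 'o \<Rightarrow> 'o
    \<Rightarrow> (('o \<times> 'a) \<times> ('o \<times> 'a),
      (('o \<times> 'a) \<times> ('o \<times> 'a) \<times> 'a) \<times> (('o \<times> 'a) \<times> ('o \<times> 'a) \<times> 'a)) cat" where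
  "Mly K A B = pullback_cat (alg_cat K (prod_func K A)) (comma_cat K K (prod_func K A) B)
     forget forget"

definition Mre :: "('o, 'a, 'm) ccat_scheme \<Rightarrow> 'o \<Rightarrow> 'o
    \<Rightarrow> (('o \<times> 'a) \<times> ('o \<times> 'a),
      (('o \<times> 'a) \<times> ('o \<times> 'a) \<times> 'a) \<times> (('o \<times> 'a) \<times> ('o \<times> 'a) \<times> 'a)) cat" where
  "Mre K A B = pullback_cat (alg_cat K (prod_func K A)) (slice_cat K B) forget forget"

end

theory Submission
  imports Defs
begin

text \<open>Fibered adjunctions are stable under strict pullback along any functor \<open>r\<close> into the base.
  The pulled-back unit has components \<open>(Ide z, \<eta> x)\<close>; these are arrows of the strict pullback
  because \<open>\<eta>\<close> is vertical, and all equations hold componentwise.\<close>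

section \<open>Strict pullbacks of categories\<close>

lemma homD:
  assumes "f \<in> hom C X Y"
  shows "f \<in> Arr C" "Dom C f = X" "Cod C f = Y"
  using assms by (auto simp: hom_def)

lemma Arr_hom: "f \<in> Arr C \<Longrightarrow> f \<in> hom C (Dom C f) (Cod C f)"
  by (simp add: hom_def)

lemma Obj_pullback_cat:
  "(x, y) \<in> Obj (pullback_cat X Y p q) \<longleftrightarrow>
     x \<in> Obj X \<and> y \<in> Obj Y \<and> obj_map p x = obj_map q y"
  by (simp add: pullback_cat_def)

lemma Arr_pullback_cat:
  "(f, g) \<in> Arr (pullback_cat X Y p q) \<longleftrightarrow>
     f \<in> Arr X \<and> g \<in> Arr Y \<and> arr_map p f = arr_map q g"
  by (simp add: pullback_cat_def)

lemma Ide_pullback_cat: "Ide (pullback_cat X Y p q) (x, y) = (Ide X x, Ide Y y)"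
  by (simp add: pullback_cat_def)

lemma Cmp_pullback_cat:
  "Cmp (pullback_cat X Y p q) (f', g') (f, g) = (Cmp X f' f, Cmp Y g' g)"
  by (simp add: pullback_cat_def)

text \<open>The right-hand side does not ask that \<open>(x, y)\<close> and \<open>(x', y')\<close>
  be matching pairs: when \<open>p\<close> and \<open>q\<close> are functors, this follows from the
  matching of \<open>f\<close> and \<open>g\<close>. With this componentwise form, each law of the
  pullback splits into the same law in \<open>X\<close> and in \<open>Y\<close>.\<close>

lemma hom_pullback_cat:
  "(f, g) \<in> hom (pullback_cat X Y p q) (x, y) (x', y') \<longleftrightarrow>
     f \<in> hom X x x' \<and> g \<in> hom Y y y' \<and> arr_map p f = arr_map q g"
  by (auto simp: pullback_cat_def hom_def)

lemmas pullback_cat_simps =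
  Obj_pullback_cat Arr_pullback_cat Ide_pullback_cat Cmp_pullback_cat hom_pullback_cat

text \<open>The laws hold componentwise. What remains is that the matching condition passes to
  endpoints, identities and composites, which is functoriality of \<open>p\<close> and
  \<open>q\<close>.\<close>

lemma category_pullback_cat:
  assumes "cat_functor X C p" and "cat_functor Y C q"
  shows "category (pullback_cat X Y p q)"
proof -
  interpret p: cat_functor X C p by fact
  interpret q: cat_functor Y C q by fact
  \<comment> \<open>Functors are axiomatized through hom-sets. The equations for \<open>Dom\<close>
    and \<open>Cod\<close> let \<open>arr_map p f = arr_map q g\<close> be read off at both
    endpoints.\<close>
  have Dom_p: "Dom C (arr_map p f) = obj_map p (Dom X f)"
    and Cod_p: "Cod C (arr_map p f) = obj_map p (Cod X f)" if "f \<in> Arr X" for f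
    using p.map_hom[OF Arr_hom[OF that]] by (auto dest: homD)
  have Dom_q: "Dom C (arr_map q f) = obj_map q (Dom Y f)"
    and Cod_q: "Cod C (arr_map q f) = obj_map q (Cod Y f)" if "f \<in> Arr Y" for f
    using q.map_hom[OF Arr_hom[OF that]] by (auto dest: homD)
  show ?thesis
  proof (unfold_locales, goal_cases)
    case (1 f)
    then show ?case
      by (auto simp: pullback_cat_def p.C.Dom_Obj q.C.Dom_Obj)
        (metis Dom_p Dom_q)
  next
    case (2 f)
    then show ?case
      by (auto simp: pullback_cat_def p.C.Cod_Obj q.C.Cod_Obj)
        (metis Cod_p Cod_q)
  next
    case (3 x)
    then show ?case
      by (cases x) (auto simp: pullback_cat_simps p.C.Ide_hom q.C.Ide_hom p.map_Ide q.map_Ide)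
  next
    case (4 f x y g z)
    then show ?case
      by (cases f; cases g; cases x; cases y; cases z)
        (auto simp: pullback_cat_simps p.map_Cmp q.map_Cmp intro: p.C.Cmp_hom q.C.Cmp_hom)
  next
    case (5 f x y)
    then show ?case
      by (cases f; cases x; cases y)
        (auto simp: pullback_cat_simps p.C.Cmp_Ide q.C.Cmp_Ide)
  next
    case (6 f x y)
    then show ?case
      by (cases f; cases x; cases y)
        (auto simp: pullback_cat_simps p.C.Ide_Cmp q.C.Ide_Cmp)
  next
    case (7 f w x g y h z)
    then show ?case
      by (cases f; cases g; cases h; cases w; cases x; cases y; cases z)
        (auto simp: pullback_cat_simps p.C.Cmp_assoc q.C.Cmp_assoc)
  qed
qed

lemma cat_functor_pullback_proj:
  assumes "cat_functor X C p" and "cat_functor Y C q"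
  shows "cat_functor (pullback_cat X Y p q) X pullback_proj"
proof -
  interpret p: cat_functor X C p by fact
  interpret P: category "pullback_cat X Y p q"
    using assms by (rule category_pullback_cat)
  show ?thesis
    by unfold_locales (auto simp: pullback_proj_def pullback_cat_simps)
qed

section \<open>Pulling back functors, transformations and adjunctions\<close>

text \<open>A matching pair \<open>(z, x)\<close> goes to \<open>(z, F x)\<close>, which matches
  again because \<open>q F = p\<close>; the same holds for arrows.\<close>

lemma cat_functor_pullback_func:
  assumes "cat_functor Z C r" and "cat_functor X C p" and "cat_functor Y C q"
    and "cat_functor X Y F" and over: "func_eq X (comp_func q F) p"
  shows "cat_functor (pullback_cat Z X r p) (pullback_cat Z Y r q) (pullback_func F)"
proof -
  interpret r: cat_functor Z C r by fact
  interpret F: cat_functor X Y F by fact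
  interpret P: category "pullback_cat Z X r p"
    using assms(1,2) by (rule category_pullback_cat)
  interpret Q: category "pullback_cat Z Y r q"
    using assms(1,3) by (rule category_pullback_cat)
  have over_obj: "obj_map q (obj_map F x) = obj_map p x" if "x \<in> Obj X" for x
    using over that by (simp add: func_eq_def comp_func_def)
  have over_arr: "arr_map q (arr_map F f) = arr_map p f" if "f \<in> hom X x y" for f x y
    using over homD(1)[OF that] by (simp add: func_eq_def comp_func_def)
  show ?thesis
    by unfold_locales
      (auto simp: pullback_func_def pullback_cat_simps over_obj over_arr
        F.map_Obj F.map_hom F.map_Ide F.map_Cmp)
qed

lemma pullback_func_id_func: "pullback_func id_func = id_func"
  by (auto simp: pullback_func_def id_func_def)

text \<open>With the preceding lemma, pulling back is strictly functorial, as an equality of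
  records. Hence the pulled-back unit and counit have exactly the source and target that
  \<open>adjunction\<close> demands.\<close>

lemma pullback_func_comp_func:
  "pullback_func (comp_func G F) = comp_func (pullback_func G) (pullback_func F)"
  by (auto simp: pullback_func_def comp_func_def)

text \<open>At \<open>(z, x)\<close> the component is \<open>(Ide Z z, \<eta> x)\<close>. Its halves
  match: \<open>r\<close> sends the first to the identity of \<open>r z\<close>, \<open>q\<close>
  sends the second to the identity of \<open>p x\<close> by verticality, and
  \<open>r z = p x\<close>. Naturality is an identity law in the first half and naturality of
  \<open>\<eta>\<close> in the second.\<close>

lemma nat_trans_pullback_trans:
  assumes "cat_functor Z C r" and "cat_functor X C p" and "cat_functor Y C q"
    and "nat_trans X Y F G \<eta>"
    and "func_eq X (comp_func q F) p" and "func_eq X (comp_func q G) p"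
    and vertical: "\<And>x. x \<in> Obj X \<Longrightarrow> arr_map q (\<eta> x) = Ide C (obj_map p x)"
  shows "nat_trans (pullback_cat Z X r p) (pullback_cat Z Y r q)
           (pullback_func F) (pullback_func G) (pullback_trans Z \<eta>)"
proof -
  interpret r: cat_functor Z C r by fact
  interpret \<eta>: nat_trans X Y F G \<eta> by fact
  interpret F: cat_functor "pullback_cat Z X r p" "pullback_cat Z Y r q" "pullback_func F"
    using assms(1-3) \<eta>.F.cat_functor_axioms assms(5) by (rule cat_functor_pullback_func)
  interpret G: cat_functor "pullback_cat Z X r p" "pullback_cat Z Y r q" "pullback_func G"
    using assms(1-3) \<eta>.G.cat_functor_axioms assms(6) by (rule cat_functor_pullback_func)
  show ?thesis
    by unfold_locales
      (auto simp: pullback_func_def pullback_trans_def pullback_cat_simps vertical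
        r.map_Ide r.C.Ide_hom r.C.Ide_Cmp r.C.Cmp_Ide \<eta>.component \<eta>.naturality)
qed

theorem fibered_adjunction_pullback:
  assumes r: "cat_functor Z C r" and adj: "fibered_adjunction C X Y p q F G \<eta> \<epsilon>"
  shows "fibered_adjunction Z (pullback_cat Z X r p) (pullback_cat Z Y r q)
           pullback_proj pullback_proj (pullback_func F) (pullback_func G)
           (pullback_trans Z \<eta>) (pullback_trans Z \<epsilon>)"
proof -
  interpret r: cat_functor Z C r by fact
  interpret A: fibered_adjunction C X Y p q F G \<eta> \<epsilon> by fact
  note p = A.p.cat_functor_axioms and q = A.q.cat_functor_axioms
  interpret F: cat_functor "pullback_cat Z X r p" "pullback_cat Z Y r q" "pullback_func F"
    using r p q A.F.cat_functor_axioms A.over_left by (rule cat_functor_pullback_func)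
  interpret G: cat_functor "pullback_cat Z Y r q" "pullback_cat Z X r p" "pullback_func G"
    using r q p A.G.cat_functor_axioms A.over_right by (rule cat_functor_pullback_func)
  \<comment> \<open>To be pulled back, the composites must lie over \<open>C\<close> too:
    \<open>p G F = q F = p\<close>, and dually. As \<open>func_eq\<close> speaks only of actual
    objects and arrows, \<open>F\<close> and \<open>G\<close> must be known to preserve
    these.\<close>
  have over_GF: "func_eq X (comp_func p (comp_func G F)) p"
    and over_FG: "func_eq Y (comp_func q (comp_func F G)) q"
    using A.over_left A.over_right A.F.map_Obj A.G.map_Obj
      A.F.map_hom[OF Arr_hom, THEN homD(1)] A.G.map_hom[OF Arr_hom, THEN homD(1)]
    by (auto simp: func_eq_def comp_func_def)
  have over_id: "func_eq W (comp_func s id_func) s" for W s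
    by (simp add: func_eq_def comp_func_def id_func_def)
  \<comment> \<open>The unit is a transformation between endofunctors of \<open>X\<close>, so both
    legs are taken to be \<open>p\<close>; for the counit both are \<open>q\<close>.\<close>
  interpret unit: nat_trans "pullback_cat Z X r p" "pullback_cat Z X r p"
      id_func "comp_func (pullback_func G) (pullback_func F)" "pullback_trans Z \<eta>"
    using nat_trans_pullback_trans
        [OF r p p A.unit.nat_trans_axioms over_id over_GF A.unit_vertical]
    by (simp add: pullback_func_id_func pullback_func_comp_func)
  interpret counit: nat_trans "pullback_cat Z Y r q" "pullback_cat Z Y r q"
      "comp_func (pullback_func F) (pullback_func G)" id_func "pullback_trans Z \<epsilon>"
    using nat_trans_pullback_trans
        [OF r q q A.counit.nat_trans_axioms over_FG over_id A.counit_vertical]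
    by (simp add: pullback_func_id_func pullback_func_comp_func)
  interpret P: cat_functor "pullback_cat Z X r p" Z pullback_proj
    using r p by (rule cat_functor_pullback_proj)
  interpret Q: cat_functor "pullback_cat Z Y r q" Z pullback_proj
    using r q by (rule cat_functor_pullback_proj)
  \<comment> \<open>This is the first component of both triangle identities; the second is the given
    triangle identity.\<close>
  have Ide_idem: "Cmp Z (Ide Z z) (Ide Z z) = Ide Z z" if "z \<in> Obj Z" for z
    using r.C.Cmp_Ide[OF r.C.Ide_hom[OF that]] .
  show ?thesis
    by unfold_locales
      (auto simp: pullback_func_def pullback_trans_def pullback_proj_def pullback_cat_simps
        func_eq_def comp_func_def Ide_idem A.triangle_left A.triangle_right)
qed

section \<open>The endofunctor \<open>A \<times> -\<close> of a Cartesian category\<close>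

context cartesian_category
begin

text \<open>The projections are jointly monic: this is the uniqueness half of
  \<open>Prod_universal\<close>, applied to the common composites.\<close>

lemma prod_eqI:
  assumes "X \<in> Obj K" and "Y \<in> Obj K"
    and "h \<in> hom K Z (Prod K X Y)" and "h' \<in> hom K Z (Prod K X Y)"
    and "Pr1 K X Y \<cdot> h = Pr1 K X Y \<cdot> h'" and "Pr2 K X Y \<cdot> h = Pr2 K X Y \<cdot> h'"
  shows "h = h'"
proof -
  have "Pr1 K X Y \<cdot> h \<in> hom K Z X" and "Pr2 K X Y \<cdot> h \<in> hom K Z Y"
    using assms Pr1_hom Pr2_hom Cmp_hom by blast+
  from Prod_universal[OF this] show ?thesis
    using assms by metis
qed

text \<open>The description by \<open>THE\<close> in \<open>prod_func\<close> is that of the pairing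
  of \<open>Pr1\<close> and \<open>f \<cdot> Pr2\<close>, so \<open>Prod_universal\<close> gives it
  a unique solution.\<close>

lemma arr_map_prod_func:
  assumes "A \<in> Obj K" and f: "f \<in> hom K X Y"
  shows "arr_map (prod_func K A) f \<in> hom K (Prod K A X) (Prod K A Y)"
    and "Pr1 K A Y \<cdot> arr_map (prod_func K A) f = Pr1 K A X"
    and "Pr2 K A Y \<cdot> arr_map (prod_func K A) f = f \<cdot> Pr2 K A X"
proof -
  have X: "X \<in> Obj K"
    using Dom_Obj homD[OF f] by blast
  have "Pr1 K A X \<in> hom K (Prod K A X) A" and "f \<cdot> Pr2 K A X \<in> hom K (Prod K A X) Y"
    using assms(1) X Pr1_hom Cmp_hom[OF Pr2_hom f] by blast+
  from theI'[OF Prod_universal[OF this]]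
  show "arr_map (prod_func K A) f \<in> hom K (Prod K A X) (Prod K A Y)"
    and "Pr1 K A Y \<cdot> arr_map (prod_func K A) f = Pr1 K A X"
    and "Pr2 K A Y \<cdot> arr_map (prod_func K A) f = f \<cdot> Pr2 K A X"
    by (simp_all add: prod_func_def homD[OF f])
qed

text \<open>Identities and composites are preserved because both sides of each equation have the
  same two projections.\<close>

lemma cat_functor_prod_func:
  assumes A: "A \<in> Obj K"
  shows "cat_functor K K (prod_func K A)"
proof (unfold_locales, goal_cases)
  case (1 X)
  then show ?case
    using A by (simp add: prod_func_def Prod_Obj)
next
  case (2 f X Y)
  then show ?case
    using arr_map_prod_func(1)[OF A] by (simp add: prod_func_def)
next
  case (3 X)
  have "arr_map (prod_func K A) (Ide K X) = Ide K (Prod K A X)"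
  proof (rule prod_eqI[OF A 3])
    show "Ide K (Prod K A X) \<in> hom K (Prod K A X) (Prod K A X)"
      using A 3 by (simp add: Ide_hom Prod_Obj)
  qed (use arr_map_prod_func[OF A Ide_hom[OF 3]] Cmp_Ide Ide_Cmp Pr1_hom[OF A 3]
      Pr2_hom[OF A 3] in \<open>auto simp: Cmp_Ide\<close>)
  then show ?case
    by (simp add: prod_func_def)
next
  case (4 f X Y g Z)
  note f = arr_map_prod_func[OF A 4(1)]
    and g = arr_map_prod_func[OF A 4(2)]
    and gf = arr_map_prod_func[OF A Cmp_hom[OF 4]]
  have X: "X \<in> Obj K" and Y: "Y \<in> Obj K" and Z: "Z \<in> Obj K"
    using 4 homD Dom_Obj Cod_Obj by metis+
  show ?case
  proof (rule prod_eqI[OF A Z gf(1) Cmp_hom[OF f(1) g(1)]])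
    show "Pr1 K A Z \<cdot> arr_map (prod_func K A) (g \<cdot> f) =
        Pr1 K A Z \<cdot> (arr_map (prod_func K A) g \<cdot> arr_map (prod_func K A) f)"
      using Cmp_assoc[OF f(1) g(1) Pr1_hom[OF A Z]] f g gf by simp
    show "Pr2 K A Z \<cdot> arr_map (prod_func K A) (g \<cdot> f) =
        Pr2 K A Z \<cdot> (arr_map (prod_func K A) g \<cdot> arr_map (prod_func K A) f)"
      \<comment> \<open>Writing \<open>T\<close> for the action on arrows, the chain is \<open>Pr2
        \<cdot> (T g \<cdot> T f) = (g \<cdot> Pr2) \<cdot> T f = g \<cdot> (f \<cdot> Pr2) = (g
        \<cdot> f) \<cdot> Pr2\<close>, with one associativity instance for each regrouping.\<close>
      using Cmp_assoc[OF f(1) g(1) Pr2_hom[OF A Z]] Cmp_assoc[OF f(1) Pr2_hom[OF A Y] 4(2)]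
        Cmp_assoc[OF Pr2_hom[OF A X] 4] f g gf by simp
  qed
qed

end

section \<open>Algebras of an endofunctor\<close>

lemma Obj_alg_cat:
  "(E, d) \<in> Obj (alg_cat C T) \<longleftrightarrow> E \<in> Obj C \<and> d \<in> hom C (obj_map T E) E"
  by (simp add: alg_cat_def)

lemma Ide_alg_cat: "Ide (alg_cat C T) (E, d) = ((E, d), (E, d), Ide C E)"
  by (simp add: alg_cat_def)

lemma Cmp_alg_cat: "Cmp (alg_cat C T) (s', t', h') (s, t, h) = (s, t', Cmp C h' h)"
  by (simp add: alg_cat_def)

lemma hom_alg_cat:
  "(s, t, h) \<in> hom (alg_cat C T) (E, d) (E', d') \<longleftrightarrow>
     s = (E, d) \<and> t = (E', d') \<and> (E, d) \<in> Obj (alg_cat C T) \<and> (E', d') \<in> Obj (alg_cat C T) \<and>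
     h \<in> hom C E E' \<and> Cmp C h d = Cmp C d' (arr_map T h)"
  by (auto simp: alg_cat_def hom_def)

lemmas alg_cat_simps = Obj_alg_cat Ide_alg_cat Cmp_alg_cat hom_alg_cat

text \<open>The unit and associativity laws are inherited from the underlying arrows. The main point
  is that morphisms compose.\<close>

lemma category_alg_cat:
  assumes "cat_functor C C T"
  shows "category (alg_cat C T)"
proof -
  interpret T: cat_functor C C T by fact
  show ?thesis
  proof (unfold_locales, goal_cases)
    case (1 f)
    then show ?case by (auto simp: alg_cat_def)
  next
    case (2 f)
    then show ?case by (auto simp: alg_cat_def)
  next
    case (3 x)
    then show ?case
      by (cases x) (auto simp: alg_cat_simps T.C.Ide_hom T.map_Ide T.C.Ide_Cmp T.C.Cmp_Ide)
  next
    case (4 f x y g z)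
    obtain E d E' d' E'' d'' where xyz: "x = (E, d)" "y = (E', d')" "z = (E'', d'')"
      by (metis surj_pair)
    obtain h k where fg: "f = (x, y, h)" "g = (y, z, k)"
      using 4 by (cases f; cases g) (auto simp: xyz alg_cat_simps)
    have d: "d \<in> hom C (obj_map T E) E" and d': "d' \<in> hom C (obj_map T E') E'"
      and d'': "d'' \<in> hom C (obj_map T E'') E''"
      and h: "h \<in> hom C E E'" and k: "k \<in> hom C E' E''"
      and hd: "Cmp C h d = Cmp C d' (arr_map T h)"
      and kd: "Cmp C k d' = Cmp C d'' (arr_map T k)"
      using 4 by (auto simp: xyz fg alg_cat_simps)
    \<comment> \<open>The commuting squares of \<open>h\<close> and \<open>k\<close> are pasted
      along \<open>d'\<close>; preservation of composites by \<open>T\<close> then joins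
      \<open>arr_map T k\<close> and \<open>arr_map T h\<close>.\<close>
    have "Cmp C (Cmp C k h) d = Cmp C k (Cmp C d' (arr_map T h))"
      using T.C.Cmp_assoc[OF d h k] hd by simp
    also have "\<dots> = Cmp C (Cmp C d'' (arr_map T k)) (arr_map T h)"
      using T.C.Cmp_assoc[OF T.map_hom[OF h] d' k] kd by simp
    also have "\<dots> = Cmp C d'' (arr_map T (Cmp C k h))"
      using T.C.Cmp_assoc[OF T.map_hom[OF h] T.map_hom[OF k] d''] T.map_Cmp[OF h k] by simp
    finally show ?case
      using 4 T.C.Cmp_hom[OF h k] by (auto simp: xyz fg alg_cat_simps)
  next
    case (5 f x y)
    then show ?case
      by (cases f; cases x; cases y) (auto simp: alg_cat_simps T.C.Cmp_Ide)
  next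
    case (6 f x y)
    then show ?case
      by (cases f; cases x; cases y) (auto simp: alg_cat_simps T.C.Ide_Cmp)
  next
    case (7 f w x g y h z)
    then show ?case
      by (cases f; cases g; cases h; cases w; cases x; cases y; cases z)
        (auto simp: alg_cat_simps T.C.Cmp_assoc)
  qed
qed

lemma cat_functor_forget_alg_cat:
  assumes "cat_functor C C T"
  shows "cat_functor (alg_cat C T) C forget"
proof -
  interpret T: cat_functor C C T by fact
  interpret A: category "alg_cat C T"
    using assms by (rule category_alg_cat)
  show ?thesis
    by unfold_locales (auto simp: forget_def alg_cat_simps)
qed

section \<open>Moore and Mealy machines\<close>

theorem corollary3p2:
  fixes K :: "('o, 'a) ccat"
    and A B :: 'o
    and F G :: "('o \<times> 'a, ('o \<times> 'a) \<times> ('o \<times> 'a) \<times> 'a,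
                 'o \<times> 'a, ('o \<times> 'a) \<times> ('o \<times> 'a) \<times> 'a) func"
    and \<eta> \<epsilon> :: "'o \<times> 'a \<Rightarrow> ('o \<times> 'a) \<times> ('o \<times> 'a) \<times> 'a"
  assumes "cartesian_category K"
    and "A \<in> Obj K" and "B \<in> Obj K"
    and "fibered_adjunction K (slice_cat K B) (comma_cat K K (prod_func K A) B) forget forget
           F G \<eta> \<epsilon>"
  shows "fibered_adjunction (alg_cat K (prod_func K A)) (Mre K A B) (Mly K A B)
           pullback_proj pullback_proj (pullback_func F) (pullback_func G)
           (pullback_trans (alg_cat K (prod_func K A)) \<eta>)
           (pullback_trans (alg_cat K (prod_func K A)) \<epsilon>)"
  \<comment> \<open>The functor \<open>r\<close> is \<open>forget\<close> on algebras, with base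
    \<open>K\<close>. That the slice and the comma category are categories with functors to
    \<open>K\<close> is contained in the assumed \<open>fibered_adjunction\<close>.\<close>
  using fibered_adjunction_pullback[OF cat_functor_forget_alg_cat
      [OF cartesian_category.cat_functor_prod_func[OF assms(1,2)]] assms(4)]
  by (simp add: Mre_def Mly_def)

end
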